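(* Let $G=(V,E)$ be a connected locally finite weighted graph with symmetric positive edge weights $w_{xy}$ and vertex measure $\mu:V\to(0,\infty)$. Suppose there is a constant $w_0>0$ such that $w_{xy}\ge w_0$ for all $x,y\in V$ with $y\sim x$. Let $O$ be a fixed point of $V$ and suppose the distance function $\rho(x)=\rho(x,O)$ belongs to $L^p(V)$ for some $p>2$. Let $h:V\to\mathbb{R}$ satisfy $h(x)\ge a_0>0$ for some constant $a_0$ and all $x\in V$. If further $1/h\in L^1(V)$ or $h(x)\to+\infty$ as $\rho(x)\to+\infty$, then for any $q$ with $2<q<p$, the equation $$-\Delta u+hu=|u|^{q-2}u\quad\text{in } V,\qquad u\in\mathscr{H},$$ has a nontrivial solution (i.e. a solution $u\not\equiv0$).
   Context: $G=(V,E)$ is a connected graph with vertex set $V$ and edge set $E$; $y\sim x$ means $xy\in E$. Each edge $xy\in E$ has a weight $w_{xy}>0$ with $w_{xy}=w_{yx}$, and $\mu:V\to(0,\infty)$ is a measure on the vertices. The distance $\rho(x,O)$ between $x$ and $O$ is the number of edges of a shortest path joining them (and $\rho(O,O)=0$). The graph is locally finite if for every $O\in V$ and every integer $k\ge1$ the ball $B_k=\{x\in V:\rho(x,O)<k\}$ is finite. For $f:V\to\mathbb{R}$, $\int_V f\,d\mu=\sum_{x\in V}\mu(x)f(x)$. For $q>0$, $L^q(V)$ is the space of functions $f:V\to\mathbb{R}$ with $\|f\|_{L^q(V)}=\left(\int_V|f|^q\,d\mu\right)^{1/q}<\infty$. The Laplacian is $\Delta u(x)=\frac{1}{\mu(x)}\sum_{y\sim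 x}w_{xy}(u(y)-u(x))$, and $|\nabla u|(x)=\left(\frac{1}{2\mu(x)}\sum_{y\sim x}w_{xy}(u(y)-u(x))^2\right)^{1/2}$. $W^{1,2}(V)$ is the space of functions $u:V\to\mathbb{R}$ with $\|u\|_{W^{1,2}(V)}=\left(\int_V(|\nabla u|^2+u^2)\,d\mu\right)^{1/2}<\infty$, and $W_0^{1,2}(V)$ is the completion (closure in $W^{1,2}(V)$) of the finitely supported functions $C_c(V)$ under this norm. For $h$ with a positive lower bound, $\mathscr{H}=\{u\in W_0^{1,2}(V):\int_V(|\nabla u|^2+hu^2)\,d\mu<\infty\}$. The equation is understood pointwise at every $x\in V$. *)

theory Defs
  imports "HOL-Analysis.Analysis"
begin

text \<open>
  Functions on the vertex set are represented by total functions on the type \<open>'a\<close>; only their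
  values on \<open>verts G\<close> matter. Edges are unordered pairs, so \<open>xy \<in> E\<close> is \<open>{x, y} \<in> edges G\<close>.
  Loops are not excluded; they contribute to neither the Laplacian nor the gradient.
\<close>

record 'a wgraph =
  verts :: "'a set"
  edges :: "'a set set"
  weight :: "'a \<Rightarrow> 'a \<Rightarrow> real"
  meas :: "'a \<Rightarrow> real"

definition adj :: "'a wgraph \<Rightarrow> 'a \<Rightarrow> 'a \<Rightarrow> bool" where
  "adj G x y \<longleftrightarrow> {x, y} \<in> edges G"

definition weighted_graph :: "'a wgraph \<Rightarrow> bool" where
  "weighted_graph G \<longleftrightarrow>
     edges G \<subseteq> {{x, y} | x y. x \<in> verts G \<and> y \<in> verts G} \<and>
     (\<forall>x y. adj G x y \<longrightarrow> weight G x y > 0 \<and> weight G x y = weight G y x) \<and>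
     (\<forall>x\<in>verts G. meas G x > 0)"

text \<open>
  A path is given by its list of vertices and has \<open>length xs - 1\<close> edges. Repeated vertices are
  allowed, which affects neither connectedness nor the length of a shortest path.
\<close>

definition graph_path :: "'a wgraph \<Rightarrow> 'a \<Rightarrow> 'a list \<Rightarrow> 'a \<Rightarrow> bool" where
  "graph_path G x xs y \<longleftrightarrow>
     xs \<noteq> [] \<and> set xs \<subseteq> verts G \<and> hd xs = x \<and> last xs = y \<and> successively (adj G) xs"

definition connected_graph :: "'a wgraph \<Rightarrow> bool" where
  "connected_graph G \<longleftrightarrow> (\<forall>x\<in>verts G. \<forall>y\<in>verts G. \<exists>xs. graph_path G x xs y)"

definition graph_dist :: "'a wgraph \<Rightarrow> 'a \<Rightarrow> 'a \<Rightarrow> nat" where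
  "graph_dist G x y = (LEAST n. \<exists>xs. graph_path G x xs y \<and> length xs = Suc n)"

definition locally_finite_graph :: "'a wgraph \<Rightarrow> bool" where
  "locally_finite_graph G \<longleftrightarrow>
     (\<forall>z\<in>verts G. \<forall>k\<ge>1. finite {x \<in> verts G. graph_dist G x z < k})"

definition graph_integrable :: "'a wgraph \<Rightarrow> ('a \<Rightarrow> real) \<Rightarrow> bool" where
  "graph_integrable G f \<longleftrightarrow> (\<lambda>x. meas G x * f x) summable_on verts G"

text \<open>Zero for functions that are not integrable.\<close>

definition graph_integral :: "'a wgraph \<Rightarrow> ('a \<Rightarrow> real) \<Rightarrow> real" where
  "graph_integral G f = (\<Sum>\<^sub>\<infinity>x\<in>verts G. meas G x * f x)"

definition Lq_space :: "'a wgraph \<Rightarrow> real \<Rightarrow> ('a \<Rightarrow> real) set" where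
  "Lq_space G q = {f. graph_integrable G (\<lambda>x. \<bar>f x\<bar> powr q)}"

definition graph_laplacian :: "'a wgraph \<Rightarrow> ('a \<Rightarrow> real) \<Rightarrow> 'a \<Rightarrow> real" where
  "graph_laplacian G u x = 1 / meas G x * (\<Sum>y | adj G x y. weight G x y * (u y - u x))"

definition grad_norm :: "'a wgraph \<Rightarrow> ('a \<Rightarrow> real) \<Rightarrow> 'a \<Rightarrow> real" where
  "grad_norm G u x =
     sqrt (1 / (2 * meas G x) * (\<Sum>y | adj G x y. weight G x y * (u y - u x)\<^sup>2))"

definition W12 :: "'a wgraph \<Rightarrow> ('a \<Rightarrow> real) set" where
  "W12 G = {u. graph_integrable G (\<lambda>x. (grad_norm G u x)\<^sup>2 + (u x)\<^sup>2)}"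

definition W12_norm :: "'a wgraph \<Rightarrow> ('a \<Rightarrow> real) \<Rightarrow> real" where
  "W12_norm G u = sqrt (graph_integral G (\<lambda>x. (grad_norm G u x)\<^sup>2 + (u x)\<^sup>2))"

definition Cc :: "'a wgraph \<Rightarrow> ('a \<Rightarrow> real) set" where
  "Cc G = {\<phi>. finite {x \<in> verts G. \<phi> x \<noteq> 0}}"

text \<open>
  The closure of \<open>Cc G\<close> in \<open>W12 G\<close>. On a locally finite graph \<open>Cc G \<subseteq> W12 G\<close>, so the norm below
  is only applied to elements of \<open>W12 G\<close>.
\<close>

definition W12_0 :: "'a wgraph \<Rightarrow> ('a \<Rightarrow> real) set" where
  "W12_0 G = {u \<in> W12 G. \<forall>\<epsilon>>0. \<exists>\<phi>\<in>Cc G. W12_norm G (\<lambda>x. u x - \<phi> x) < \<epsilon>}"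

definition H_space :: "'a wgraph \<Rightarrow> ('a \<Rightarrow> real) \<Rightarrow> ('a \<Rightarrow> real) set" where
  "H_space G h = {u \<in> W12_0 G. graph_integrable G (\<lambda>x. (grad_norm G u x)\<^sup>2 + h x * (u x)\<^sup>2)}"

end

theory Submission
  imports Defs "HOL-Complex_Analysis.Great_Picard"
begin

text \<open>
  Along a shortest path the energy \<open>J(u) = \<integral>(|\<nabla>u|\<^sup>2 + h u\<^sup>2) d\<mu>\<close> controls \<open>u\<close> pointwise:
  \<open>|u(x)| \<le> K (1 + \<rho>(x)) sqrt (J(u))\<close>. Since \<open>(1 + \<rho>)\<^sup>q\<close> is integrable, a pointwise convergent
  sequence of bounded energy converges in \<open>L\<^sup>q\<close> by dominated convergence. Take a sequence of
  finitely supported functions with \<open>\<integral>|\<phi>|\<^sup>q d\<mu> = 1\<close> minimising \<open>J\<close>; by a diagonal argument it may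
  be assumed to converge pointwise, and by the parallelogram law it is Cauchy in the energy norm.
  Perturbing it by multiples of a point mass gives the Euler--Lagrange equation of the limit, and
  scaling removes the Lagrange multiplier.
\<close>

section \<open>Real-analysis preliminaries\<close>

text \<open>Away from 0 the sign of \<open>s\<close> is locally constant and the power rule applies;
  at 0 the difference quotient is at most \<open>\<bar>t\<bar> powr (q - 1)\<close>, which tends to
  0. The derivative is written so as to match the nonlinearity of the equation.\<close>

lemma DERIV_abs_powr:
  fixes s q :: real
  assumes "1 < q"
  shows "((\<lambda>t. \<bar>t\<bar> powr q) has_real_derivative q * (\<bar>s\<bar> powr (q - 2) * s)) (at s)"
proof -
  consider "s > 0" | "s < 0" | "s = 0" by linarith
  then show ?thesis
  proof cases
    case 1
    have "((\<lambda>t. t powr q) has_real_derivative q * s powr (q - 1)) (at s)"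
      using has_real_derivative_powr[OF 1] .
    moreover have "q * s powr (q - 1) = q * (\<bar>s\<bar> powr (q - 2) * s)"
      using 1 powr_mult_base[of s "q - 2"] by (simp add: mult.commute)
    ultimately have "((\<lambda>t. t powr q) has_real_derivative q * (\<bar>s\<bar> powr (q - 2) * s)) (at s)"
      by simp
    then show ?thesis
      by (rule has_field_derivative_transform_within_open[where S = "{0<..}"]) (use 1 in auto)
  next
    case 2
    have "((\<lambda>t. (- t) powr q) has_real_derivative - (q * (- s) powr (q - 1))) (at s)"
      by (rule derivative_eq_intros refl | use 2 in simp)+
    moreover have "(- s) powr (q - 1) = - (\<bar>s\<bar> powr (q - 2) * s)"
      using 2 powr_mult_base[of "- s" "q - 2"] by (simp add: mult.commute)
    ultimately have "((\<lambda>t. (- t) powr q) has_real_derivative q * (\<bar>s\<bar> powr (q - 2) * s)) (at s)"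
      by simp
    then show ?thesis
      by (rule has_field_derivative_transform_within_open[where S = "{..<0}"]) (use 2 in auto)
  next
    case 3
    have "((\<lambda>t::real. \<bar>t\<bar> powr (q - 1)) \<longlongrightarrow> 0) (at 0)"
      by (rule tendsto_eq_intros refl | use assms in simp)+
    then have "((\<lambda>t::real. \<bar>t\<bar> powr q / t) \<longlongrightarrow> 0) (at 0)"
    proof (rule Lim_null_comparison[rotated])
      show "\<forall>\<^sub>F t::real in at 0. norm (\<bar>t\<bar> powr q / t) \<le> \<bar>t\<bar> powr (q - 1)"
        by (auto simp: eventually_at_filter powr_diff)
    qed
    then show ?thesis
      using 3 assms by (simp add: has_field_derivative_iff)
  qed
qed

text \<open>Stated for an arbitrary filter so that it also applies to double sequences.\<close>

lemma tendsto_infsum_dominated: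
  fixes f :: "'b \<Rightarrow> 'a \<Rightarrow> real" and g b :: "'a \<Rightarrow> real"
  assumes b: "b summable_on A"
    and lim: "\<And>x. x \<in> A \<Longrightarrow> ((\<lambda>n. f n x) \<longlongrightarrow> g x) F"
    and dom: "\<And>n x. x \<in> A \<Longrightarrow> \<bar>f n x\<bar> \<le> b x"
    and dom_lim: "\<And>x. x \<in> A \<Longrightarrow> \<bar>g x\<bar> \<le> b x"
  shows "((\<lambda>n. infsum (f n) A) \<longlongrightarrow> infsum g A) F"
proof (rule tendstoI)
  fix e :: real assume "e > 0"
  have summable: "k summable_on A" if "\<And>x. x \<in> A \<Longrightarrow> \<bar>k x\<bar> \<le> b x" for k
    using that by (intro abs_summable_summable[OF summable_on_comparison_test[OF b]]) auto
  \<comment> \<open>A finite \<open>S\<close> carries all but \<open>e / 4\<close> of the majorant,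
    so the tails of \<open>f n\<close> and \<open>g\<close> are each at most \<open>e / 4\<close>;
    the finite sums over \<open>S\<close> contribute another \<open>e / 4\<close>.\<close>
  obtain S where S: "finite S" "S \<subseteq> A" "dist (sum b S) (infsum b A) \<le> e / 4"
    using infsum_finite_approximation[OF b, of "e / 4"] \<open>e > 0\<close> by auto
  have tail: "\<bar>infsum k A - sum k S\<bar> \<le> e / 4"
    if k: "\<And>x. x \<in> A \<Longrightarrow> \<bar>k x\<bar> \<le> b x" for k
  proof -
    note k_sum = summable[OF k]
    have kS: "k summable_on (A - S)" and bS: "b summable_on (A - S)"
      using k_sum b by (auto intro: summable_on_subset_banach)
    have split: "infsum c A - sum c S = infsum c (A - S)" if "c summable_on A" for c :: "'a \<Rightarrow> real"
      using infsum_Diff[of c A S] that S by simp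
    have "infsum k (A - S) \<le> infsum b (A - S)"
      using k by (intro infsum_mono kS bS) force
    moreover have "infsum (\<lambda>x. - k x) (A - S) \<le> infsum b (A - S)"
      using k kS by (intro infsum_mono bS) (force simp: summable_on_uminus)+
    ultimately have "\<bar>infsum k (A - S)\<bar> \<le> infsum b (A - S)"
      by (simp add: infsum_uminus)
    also have "\<dots> \<le> e / 4"
      using split[OF b] S(3) unfolding dist_real_def by linarith
    finally show ?thesis
      using split[OF k_sum] by simp
  qed
  have "((\<lambda>n. sum (f n) S) \<longlongrightarrow> sum g S) F"
    using S(2) by (intro tendsto_sum lim) auto
  then have "\<forall>\<^sub>F n in F. dist (sum (f n) S) (sum g S) < e / 4"
    using \<open>e > 0\<close> by (intro tendstoD) auto
  then show "\<forall>\<^sub>F n in F. dist (infsum (f n) A) (infsum g A) < e"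
  proof eventually_elim
    case (elim n)
    with tail[of "f n", OF dom] tail[OF dom_lim] \<open>e > 0\<close> show ?case
      unfolding dist_real_def by linarith
  qed
qed

text \<open>Telescoping with the triangle inequality. With \<open>P\<close> the adjacency relation,
  this turns a bound across edges into one proportional to the length of a path.\<close>

lemma hd_last_diff_le:
  fixes f :: "'a \<Rightarrow> real"
  assumes "xs \<noteq> []" and "successively P xs"
    and "\<And>a b. a \<in> set xs \<Longrightarrow> P a b \<Longrightarrow> \<bar>f a - f b\<bar> \<le> d"
  shows "\<bar>f (hd xs) - f (last xs)\<bar> \<le> real (length xs - 1) * d"
  using assms
proof (induction xs rule: induct_list012)
  case (3 x y zs)
  have "\<bar>f x - f y\<bar> \<le> d"
    using 3 by simp
  moreover have "\<bar>f y - f (last (y # zs))\<bar> \<le> real (length (y # zs) - 1) * d"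
    using 3 by auto
  ultimately show ?case
    by (simp add: algebra_simps)
qed auto

section \<open>Neighbours, balls and shortest paths\<close>

locale schroedinger_graph =
  fixes G :: "'a wgraph" and h :: "'a \<Rightarrow> real" and a0 :: real
  assumes weighted: "weighted_graph G" and connected: "connected_graph G"
    and locally_finite: "locally_finite_graph G"
    and a0_pos: "a0 > 0" and h_ge: "\<And>x. x \<in> verts G \<Longrightarrow> h x \<ge> a0"
begin

abbreviation V where "V \<equiv> verts G"

definition nbrs :: "'a \<Rightarrow> 'a set" where "nbrs x = {y. adj G x y}"

lemma adj_verts: "adj G x y \<Longrightarrow> x \<in> V \<and> y \<in> V"
  using weighted unfolding weighted_graph_def adj_def by (fastforce simp: doubleton_eq_iff)

lemma adj_sym: "adj G x y \<longleftrightarrow> adj G y x"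
  by (simp add: adj_def insert_commute)

lemma weight_pos: "adj G x y \<Longrightarrow> weight G x y > 0"
  and weight_sym: "adj G x y \<Longrightarrow> weight G x y = weight G y x"
  and meas_pos: "x \<in> V \<Longrightarrow> meas G x > 0"
  using weighted unfolding weighted_graph_def by auto

lemma h_pos: "x \<in> V \<Longrightarrow> h x > 0"
  using h_ge a0_pos by fastforce

text \<open>The neighbours of a vertex lie in its ball of radius 2, which is finite; outside
  \<open>V\<close> there are no edges.\<close>

lemma finite_nbrs: "finite (nbrs x)"
proof (cases "x \<in> V")
  case True
  have "graph_dist G y x < 2" if "adj G x y" for y
  proof -
    have "graph_dist G y x \<le> 1"
      unfolding graph_dist_def using that adj_verts[OF that]
      by (intro Least_le exI[of _ "[y, x]"]) (auto simp: graph_path_def adj_sym)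
    then show ?thesis by simp
  qed
  then have "nbrs x \<subseteq> {y \<in> V. graph_dist G y x < 2}"
    using adj_verts by (auto simp: nbrs_def)
  moreover have "finite {y \<in> V. graph_dist G y x < 2}"
    using locally_finite True by (simp add: locally_finite_graph_def)
  ultimately show ?thesis by (rule finite_subset)
next
  case False
  then have "nbrs x = {}"
    using adj_verts by (auto simp: nbrs_def)
  then show ?thesis by simp
qed

text \<open>\<open>V\<close> is the union of the finite balls about one vertex. Countability is what
  the diagonal argument needs.\<close>

lemma countable_verts: "countable V"
proof (cases "V = {}")
  case False
  then obtain z where z: "z \<in> V" by auto
  have "V \<subseteq> (\<Union>k. {x \<in> V. graph_dist G x z < Suc k})"
    by (auto intro: lessI)
  moreover have "countable (\<Union>k. {x \<in> V. graph_dist G x z < Suc k})"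
    using locally_finite[unfolded locally_finite_graph_def, rule_format, OF z]
    by (intro countable_UN[OF countableI_type] countable_finite) auto
  ultimately show ?thesis by (rule countable_subset)
qed simp

lemma ex_shortest_path:
  assumes "x \<in> V" "y \<in> V"
  obtains xs where "graph_path G x xs y" "length xs = Suc (graph_dist G x y)"
proof -
  obtain xs where "graph_path G x xs y"
    using connected assms by (auto simp: connected_graph_def)
  then have "\<exists>n xs. graph_path G x xs y \<and> length xs = Suc n"
    by (intro exI[of _ "length xs - 1"] exI[of _ xs]) (auto simp: graph_path_def)
  then have "\<exists>xs. graph_path G x xs y \<and> length xs = Suc (graph_dist G x y)"
    unfolding graph_dist_def by (rule LeastI_ex)
  then show ?thesis using that by auto
qed

section \<open>The energy form and its algebra\<close>

text \<open>The density at \<open>x\<close> of \<open>\<integral>(\<nabla>u \<cdot> \<nabla>v + h u v) d\<mu>\<close>, with the factor \<open>\<mu>(x)\<close> included.\<close>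

definition bform :: "('a \<Rightarrow> real) \<Rightarrow> ('a \<Rightarrow> real) \<Rightarrow> 'a \<Rightarrow> real" where
  "bform u v x = (\<Sum>y\<in>nbrs x. weight G x y * (u y - u x) * (v y - v x)) / 2
     + meas G x * h x * u x * v x"

text \<open>A divergent series gets the value 0 here, so estimates by the energy also assume
  \<open>finite_energy\<close>.\<close>

definition energy :: "('a \<Rightarrow> real) \<Rightarrow> real" where
  "energy u = (\<Sum>\<^sub>\<infinity>x\<in>V. bform u u x)"

definition finite_energy :: "('a \<Rightarrow> real) \<Rightarrow> bool" where
  "finite_energy u \<longleftrightarrow> bform u u summable_on V"

lemma bform_commute: "bform u v x = bform v u x"
  unfolding bform_def by (simp add: mult.commute mult.left_commute)

lemma bform_add_left: "bform (\<lambda>x. u x + v x) w x = bform u w x + bform v w x"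
proof -
  have "(\<Sum>y\<in>nbrs x. weight G x y * (u y + v y - (u x + v x)) * (w y - w x)) =
      (\<Sum>y\<in>nbrs x. weight G x y * (u y - u x) * (w y - w x)) +
      (\<Sum>y\<in>nbrs x. weight G x y * (v y - v x) * (w y - w x))"
    unfolding sum.distrib[symmetric] by (intro sum.cong refl) (simp add: algebra_simps)
  then show ?thesis
    unfolding bform_def by (simp add: algebra_simps add_divide_distrib)
qed

lemma bform_scale_left: "bform (\<lambda>x. c * u x) w x = c * bform u w x"
proof -
  have "(\<Sum>y\<in>nbrs x. weight G x y * (c * u y - c * u x) * (w y - w x)) =
      c * (\<Sum>y\<in>nbrs x. weight G x y * (u y - u x) * (w y - w x))"
    unfolding sum_distrib_left by (intro sum.cong refl) (simp add: algebra_simps)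
  then show ?thesis
    unfolding bform_def by (simp add: algebra_simps)
qed

lemma bform_add_right: "bform w (\<lambda>x. u x + v x) x = bform w u x + bform w v x"
  by (metis bform_add_left bform_commute)

lemma bform_scale_right: "bform w (\<lambda>x. c * u x) x = c * bform w u x"
  by (metis bform_scale_left bform_commute)

lemma bform_diff_left: "bform (\<lambda>x. u x - v x) w x = bform u w x - bform v w x"
  using bform_add_left[of u "\<lambda>x. (-1) * v x" w x] by (simp add: bform_scale_left[of "-1", simplified])

lemma bform_diff_right: "bform w (\<lambda>x. u x - v x) x = bform w u x - bform w v x"
  by (metis bform_diff_left bform_commute)

lemma bform_nonneg: "x \<in> V \<Longrightarrow> bform u u x \<ge> 0"
  unfolding bform_def using meas_pos h_pos weight_pos
  by (intro add_nonneg_nonneg divide_nonneg_nonneg sum_nonneg)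
     (auto simp: nbrs_def mult.assoc less_imp_le intro!: mult_nonneg_nonneg)

lemma bform_eq_grad_norm:
  assumes "x \<in> V"
  shows "bform u u x = meas G x * ((grad_norm G u x)\<^sup>2 + h x * (u x)\<^sup>2)"
proof -
  have "(\<Sum>y | adj G x y. weight G x y * (u y - u x)\<^sup>2) \<ge> 0"
    using weight_pos by (intro sum_nonneg) (auto simp: less_imp_le)
  then have "(grad_norm G u x)\<^sup>2 = 1 / (2 * meas G x) * (\<Sum>y | adj G x y. weight G x y * (u y - u x)\<^sup>2)"
    unfolding grad_norm_def using meas_pos[OF assms] by (intro real_sqrt_pow2) simp
  then show ?thesis
    using meas_pos[OF assms] by (simp add: bform_def nbrs_def field_simps power2_eq_square)
qed

lemma energy_nonneg: "energy u \<ge> 0"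
  unfolding energy_def by (intro infsum_nonneg bform_nonneg)

lemma bform_le_energy: "finite_energy u \<Longrightarrow> x \<in> V \<Longrightarrow> bform u u x \<le> energy u"
  using finite_sum_le_infsum[of "bform u u" V "{x}"] bform_nonneg
  by (simp add: finite_energy_def energy_def)

lemma finite_energy_scale: "finite_energy u \<Longrightarrow> finite_energy (\<lambda>x. c * u x)"
  unfolding finite_energy_def bform_scale_left bform_scale_right by (intro summable_on_cmult_right)

lemma energy_scale: "energy (\<lambda>x. c * u x) = c\<^sup>2 * energy u"
  unfolding energy_def bform_scale_left bform_scale_right
  by (simp add: infsum_cmult_right' mult.assoc power2_eq_square)

lemma parallelogram_bform:
  "bform (\<lambda>x. u x + v x) (\<lambda>x. u x + v x) x + bform (\<lambda>x. u x - v x) (\<lambda>x. u x - v x) x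
   = 2 * bform u u x + 2 * bform v v x"
  by (simp add: bform_add_left bform_add_right bform_diff_left bform_diff_right)

text \<open>Both densities on the left of the parallelogram identity are nonnegative, so each is
  dominated by the summable right-hand side.\<close>

lemma finite_energy_add_diff:
  assumes "finite_energy u" "finite_energy v"
  shows "finite_energy (\<lambda>x. u x + v x)" "finite_energy (\<lambda>x. u x - v x)"
proof -
  have s: "(\<lambda>x. 2 * bform u u x + 2 * bform v v x) summable_on V"
    using assms unfolding finite_energy_def by (intro summable_on_add summable_on_cmult_right)
  show "finite_energy (\<lambda>x. u x + v x)" "finite_energy (\<lambda>x. u x - v x)"
    unfolding finite_energy_def
    using parallelogram_bform[of u v] bform_nonneg
    by (auto intro!: summable_on_comparison_test[OF s] simp flip: parallelogram_bform)
qed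

lemma parallelogram_energy:
  assumes "finite_energy u" "finite_energy v"
  shows "energy (\<lambda>x. u x + v x) + energy (\<lambda>x. u x - v x) = 2 * energy u + 2 * energy v"
proof -
  have "energy (\<lambda>x. u x + v x) + energy (\<lambda>x. u x - v x) =
      (\<Sum>\<^sub>\<infinity>x\<in>V. bform (\<lambda>x. u x + v x) (\<lambda>x. u x + v x) x + bform (\<lambda>x. u x - v x) (\<lambda>x. u x - v x) x)"
    using finite_energy_add_diff[OF assms] unfolding energy_def finite_energy_def
    by (intro infsum_add[symmetric])
  also have "\<dots> = (\<Sum>\<^sub>\<infinity>x\<in>V. 2 * bform u u x + 2 * bform v v x)"
    by (simp add: parallelogram_bform)
  also have "\<dots> = 2 * energy u + 2 * energy v"
    using assms unfolding energy_def finite_energy_def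
    by (simp add: infsum_add infsum_cmult_right' summable_on_cmult_right)
  finally show ?thesis .
qed

text \<open>The density vanishes off the support and its neighbours, which form a finite
  set.\<close>

lemma finite_energy_Cc:
  assumes "\<phi> \<in> Cc G"
  shows "finite_energy \<phi>"
proof -
  define S where "S = {x \<in> V. \<phi> x \<noteq> 0}"
  have fin: "finite (S \<union> (\<Union>y\<in>S. nbrs y))"
    using assms finite_nbrs by (auto simp: S_def Cc_def)
  have "bform \<phi> \<phi> x = 0" if "x \<in> V" "x \<notin> S \<union> (\<Union>y\<in>S. nbrs y)" for x
  proof -
    have "\<phi> y = 0" if "y \<in> nbrs x" for y
      using that \<open>x \<notin> _\<close> adj_sym[of x y] adj_verts[of x y] by (auto simp: S_def nbrs_def)
    moreover have "\<phi> x = 0"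
      using that by (auto simp: S_def)
    ultimately show ?thesis
      by (simp add: bform_def)
  qed
  then have "bform \<phi> \<phi> summable_on V \<longleftrightarrow> bform \<phi> \<phi> summable_on (S \<union> (\<Union>y\<in>S. nbrs y)) \<inter> V"
    by (intro summable_on_cong_neutral) auto
  then show ?thesis
    using fin by (simp add: finite_energy_def)
qed

text \<open>Expanding the quadratic form leaves the cross term
  \<open>bform u (indicator {a})\<close>, which lives on \<open>a\<close> and its neighbours. Its
  sum is computed by summation by parts against a point mass, and this is where the Laplacian
  appears.\<close>

lemma energy_add_indicator:
  assumes u: "finite_energy u" and a: "a \<in> V"
  shows "energy (\<lambda>x. u x + t * indicator {a} x) =
    energy u + 2 * t * (meas G a * (- graph_laplacian G u a + h a * u a))
      + t\<^sup>2 * energy (indicator {a})"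
proof -
  define \<delta> :: "'a \<Rightarrow> real" where "\<delta> = indicator {a}"
  define B where "B = meas G a * (- graph_laplacian G u a + h a * u a)"
  \<comment> \<open>Loops are allowed, so \<open>a\<close> may be its own neighbour; removing it
    changes no sum, since a loop contributes 0.\<close>
  define N where "N = nbrs a - {a}"
  have N: "finite N" "a \<notin> N" "insert a N \<subseteq> V"
    using finite_nbrs a adj_verts by (auto simp: N_def nbrs_def)
  have dc: "\<delta> \<in> Cc G"
    by (auto simp: \<delta>_def Cc_def indicator_def)
  have drop_loop: "(\<Sum>y\<in>N. f y) = (\<Sum>y\<in>nbrs a. f y)" if "f a = 0" for f :: "'a \<Rightarrow> real"
    unfolding N_def using that finite_nbrs by (intro sum.mono_neutral_left) auto
  have at_a: "bform u \<delta> a = - (\<Sum>y\<in>N. weight G a y * (u y - u a)) / 2 + meas G a * h a * u a"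
  proof -
    have "(\<Sum>y\<in>nbrs a. weight G a y * (u y - u a) * (\<delta> y - \<delta> a)) =
        (\<Sum>y\<in>N. weight G a y * (u y - u a) * (\<delta> y - \<delta> a))"
      by (rule drop_loop[symmetric]) simp
    also have "\<dots> = (\<Sum>y\<in>N. - (weight G a y * (u y - u a)))"
      using N by (intro sum.cong refl) (auto simp: \<delta>_def indicator_def)
    finally show ?thesis
      unfolding bform_def by (simp add: sum_negf \<delta>_def)
  qed
  have at_nbr: "bform u \<delta> x = - (weight G a x * (u x - u a)) / 2" if "x \<in> N" for x
  proof -
    have adj: "adj G x a" "x \<noteq> a"
      using that adj_sym by (auto simp: N_def nbrs_def)
    then have "\<delta> x = 0" by (simp add: \<delta>_def)
    have "(\<Sum>y\<in>nbrs x. weight G x y * (u y - u x) * (\<delta> y - \<delta> x)) =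
        (\<Sum>y\<in>nbrs x. if y = a then weight G x a * (u a - u x) else 0)"
      using adj by (intro sum.cong refl) (auto simp: \<delta>_def)
    also have "\<dots> = weight G x a * (u a - u x)"
      using adj finite_nbrs by (simp add: nbrs_def)
    finally show ?thesis
      using adj \<open>\<delta> x = 0\<close> weight_sym[of x a] by (simp add: bform_def algebra_simps)
  qed
  have off: "bform u \<delta> x = 0" if "x \<in> V - insert a N" for x
  proof -
    have "\<delta> x = 0" "\<And>y. y \<in> nbrs x \<Longrightarrow> \<delta> y = 0"
      using that adj_sym by (auto simp: \<delta>_def N_def nbrs_def indicator_def)
    then show ?thesis by (simp add: bform_def)
  qed
  have "B = - (\<Sum>y\<in>N. weight G a y * (u y - u a)) + meas G a * h a * u a"
    using meas_pos[OF a] drop_loop[of "\<lambda>y. weight G a y * (u y - u a)"]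
    by (simp add: B_def graph_laplacian_def nbrs_def algebra_simps)
  \<comment> \<open>The factor 1/2 in \<open>bform\<close> puts half of each edge term at
    \<open>a\<close> and half at the neighbour; together they give the full Laplacian sum.\<close>
  also have "\<dots> = (\<Sum>x\<in>insert a N. bform u \<delta> x)"
    using N at_nbr by (simp add: at_a sum_negf flip: sum_divide_distrib)
  finally have hs: "(bform u \<delta> has_sum B) V"
    using N off by (intro has_sum_finite_neutralI[of "insert a N"]) auto
  have "((\<lambda>x. bform u u x + (2 * t) * bform u \<delta> x + t\<^sup>2 * bform \<delta> \<delta> x) has_sum
      energy u + (2 * t) * B + t\<^sup>2 * energy \<delta>) V"
    using u finite_energy_Cc[OF dc] hs unfolding finite_energy_def energy_def
    by (intro has_sum_add has_sum_cmult_right has_sum_infsum)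
  moreover have "bform (\<lambda>x. u x + t * \<delta> x) (\<lambda>x. u x + t * \<delta> x) =
      (\<lambda>x. bform u u x + (2 * t) * bform u \<delta> x + t\<^sup>2 * bform \<delta> \<delta> x)"
    by (intro ext) (simp add: bform_add_left bform_add_right bform_scale_left bform_scale_right
        bform_commute[of \<delta> u] power2_eq_square algebra_simps)
  ultimately have "energy (\<lambda>x. u x + t * \<delta> x) = energy u + (2 * t) * B + t\<^sup>2 * energy \<delta>"
    unfolding energy_def[of "\<lambda>x. u x + t * \<delta> x"] by (simp only: infsumI)
  then show ?thesis
    unfolding \<delta>_def B_def .
qed

section \<open>Lower semicontinuity of the energy and membership in \<open>H_space\<close>\<close>

lemma tendsto_bform:
  assumes "\<And>x. x \<in> V \<Longrightarrow> ((\<lambda>n. f n x) \<longlongrightarrow> u x) F" "x \<in> V"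
  shows "((\<lambda>n. bform (f n) (f n) x) \<longlongrightarrow> bform u u x) F"
  unfolding bform_def using assms adj_verts
  by (intro tendsto_intros) (auto simp: nbrs_def)

text \<open>Densities are nonnegative, so every finite partial sum for \<open>f n\<close> is at most
  \<open>c\<close>. Finite sums pass to the pointwise limit, and their supremum is the energy of
  \<open>u\<close>.\<close>

lemma energy_Fatou:
  assumes f: "\<And>n. finite_energy (f n)"
    and lim: "\<And>x. x \<in> V \<Longrightarrow> ((\<lambda>n. f n x) \<longlongrightarrow> u x) F" and "F \<noteq> bot"
    and le: "\<forall>\<^sub>F n in F. energy (f n) \<le> c"
  shows "finite_energy u" "energy u \<le> c"
proof -
  have part: "sum (bform u u) S \<le> c" if S: "finite S" "S \<subseteq> V" for S
  proof (rule tendsto_upperbound[OF _ _ \<open>F \<noteq> bot\<close>])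
    show "((\<lambda>n. sum (bform (f n) (f n)) S) \<longlongrightarrow> sum (bform u u) S) F"
      using S by (intro tendsto_sum tendsto_bform lim) auto
    show "\<forall>\<^sub>F n in F. sum (bform (f n) (f n)) S \<le> c"
      using le
    proof eventually_elim
      case (elim n)
      have "sum (bform (f n) (f n)) S \<le> energy (f n)"
        using f[of n] S bform_nonneg unfolding energy_def finite_energy_def
        by (intro finite_sum_le_infsum) auto
      with elim show ?case by simp
    qed
  qed
  have "bform u u summable_on V"
    using part bform_nonneg by (intro nonneg_bdd_above_summable_on bdd_aboveI[of _ c]) auto
  then show "finite_energy u" "energy u \<le> c"
    using part by (auto simp: finite_energy_def energy_def intro: infsum_le_finite_sums)
qed

lemma W12_norm_le_energy:
  assumes "finite_energy u"
  shows "u \<in> W12 G" "W12_norm G u \<le> sqrt ((1 + 1 / a0) * energy u)"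
proof -
  have le: "meas G x * ((grad_norm G u x)\<^sup>2 + (u x)\<^sup>2) \<le> (1 + 1 / a0) * bform u u x"
    if x: "x \<in> V" for x
  proof -
    \<comment> \<open>The summand 1 of the constant serves the gradient term, and
      \<open>h x / a0 \<ge> 1\<close> serves the zero-order term.\<close>
    have "1 \<le> (1 + 1 / a0) * h x"
      using h_ge[OF x] h_pos[OF x] a0_pos by (simp add: field_simps add_increasing2)
    then have "1 * (u x)\<^sup>2 \<le> ((1 + 1 / a0) * h x) * (u x)\<^sup>2"
      by (rule mult_right_mono) simp
    moreover have "1 * (grad_norm G u x)\<^sup>2 \<le> (1 + 1 / a0) * (grad_norm G u x)\<^sup>2"
      using a0_pos by (intro mult_right_mono) auto
    ultimately have "(grad_norm G u x)\<^sup>2 + (u x)\<^sup>2 \<le> (1 + 1 / a0) * ((grad_norm G u x)\<^sup>2 + h x * (u x)\<^sup>2)"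
      by (simp add: ring_distribs mult.assoc)
    then show ?thesis
      unfolding bform_eq_grad_norm[OF x] using meas_pos[OF x] by (simp add: mult.left_commute)
  qed
  have s: "(\<lambda>x. (1 + 1 / a0) * bform u u x) summable_on V"
    using assms unfolding finite_energy_def by (rule summable_on_cmult_right)
  have s': "(\<lambda>x. meas G x * ((grad_norm G u x)\<^sup>2 + (u x)\<^sup>2)) summable_on V"
    using s le by (rule summable_on_comparison_test) (use meas_pos in \<open>auto simp: less_imp_le\<close>)
  then show "u \<in> W12 G"
    by (simp add: W12_def graph_integrable_def)
  have "graph_integral G (\<lambda>x. (grad_norm G u x)\<^sup>2 + (u x)\<^sup>2) \<le> (\<Sum>\<^sub>\<infinity>x\<in>V. (1 + 1 / a0) * bform u u x)"
    unfolding graph_integral_def using s' s le by (rule infsum_mono)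
  then show "W12_norm G u \<le> sqrt ((1 + 1 / a0) * energy u)"
    by (simp add: W12_norm_def energy_def infsum_cmult_right')
qed

text \<open>The energy dominates the squared \<open>W12_norm\<close> up to a constant, so
  approximation in energy gives membership in the closure of \<open>Cc G\<close>.\<close>

lemma H_spaceI:
  assumes u: "finite_energy u" and f: "\<And>n::nat. f n \<in> Cc G"
    and lim: "(\<lambda>n. energy (\<lambda>x. u x - f n x)) \<longlonglongrightarrow> 0"
  shows "u \<in> H_space G h"
proof -
  have "\<exists>\<phi>\<in>Cc G. W12_norm G (\<lambda>x. u x - \<phi> x) < \<epsilon>" if "\<epsilon> > 0" for \<epsilon>
  proof -
    have "(\<lambda>n. sqrt ((1 + 1 / a0) * energy (\<lambda>x. u x - f n x))) \<longlonglongrightarrow> sqrt ((1 + 1 / a0) * 0)"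
      by (intro tendsto_intros lim)
    then have "\<forall>\<^sub>F n in sequentially. sqrt ((1 + 1 / a0) * energy (\<lambda>x. u x - f n x)) < \<epsilon>"
      using that by (auto dest: order_tendstoD(2))
    then obtain n where "sqrt ((1 + 1 / a0) * energy (\<lambda>x. u x - f n x)) < \<epsilon>"
      by (auto simp: eventually_sequentially)
    moreover have "finite_energy (\<lambda>x. u x - f n x)"
      using u f finite_energy_Cc by (intro finite_energy_add_diff) auto
    ultimately show ?thesis
      using W12_norm_le_energy(2) f by (meson le_less_trans)
  qed
  then have "u \<in> W12_0 G"
    using W12_norm_le_energy(1)[OF u] by (simp add: W12_0_def)
  moreover have "graph_integrable G (\<lambda>x. (grad_norm G u x)\<^sup>2 + h x * (u x)\<^sup>2)"
    using u by (simp add: finite_energy_def graph_integrable_def bform_eq_grad_norm cong: summable_on_cong)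
  ultimately show ?thesis
    by (simp add: H_space_def)
qed

end


section \<open>Pointwise growth bounds in terms of the energy\<close>

locale schroedinger_nonlinear = schroedinger_graph +
  fixes w0 p q :: real and z :: 'a
  assumes w0_pos: "w0 > 0" and weight_ge: "\<And>x y. adj G x y \<Longrightarrow> weight G x y \<ge> w0"
    and z_vert: "z \<in> verts G"
    and dist_Lp: "(\<lambda>x. real (graph_dist G x z)) \<in> Lq_space G p"
    and q_gt: "2 < q" and q_less: "q < p"
begin

text \<open>The summand 1 accounts for the value at the base vertex \<open>z\<close> and makes
  division by \<open>growth x\<close> possible.\<close>

abbreviation growth :: "'a \<Rightarrow> real" where "growth x \<equiv> 1 + real (graph_dist G x z)"

lemma growth_pos: "growth x > 0"
  by simp

text \<open>A single edge term is at most twice the density at \<open>x\<close>, because of the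
  factor 1/2 in \<open>bform\<close>; dividing by the lower bound \<open>w0\<close> gives
  \<open>2 / w0\<close>.\<close>

lemma diff_le_energy:
  assumes "finite_energy u" "adj G x y"
  shows "\<bar>u x - u y\<bar> \<le> sqrt (2 / w0 * energy u)"
proof (rule real_le_rsqrt)
  have x: "x \<in> V" using assms(2) adj_verts by blast
  have "w0 * (u x - u y)\<^sup>2 \<le> weight G x y * (u x - u y)\<^sup>2"
    using weight_ge[OF assms(2)] by (intro mult_right_mono) auto
  also have "\<dots> = weight G x y * (u y - u x) * (u y - u x)"
    by (simp add: power2_eq_square algebra_simps)
  also have "\<dots> \<le> (\<Sum>y\<in>nbrs x. weight G x y * (u y - u x) * (u y - u x))"
    using assms(2) finite_nbrs weight_pos
    by (intro member_le_sum) (auto simp: nbrs_def mult.assoc less_imp_le)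
  also have "\<dots> \<le> 2 * bform u u x"
    using meas_pos[OF x] h_pos[OF x] by (simp add: bform_def mult.assoc)
  also have "\<dots> \<le> 2 * energy u"
    using bform_le_energy[OF assms(1) x] by simp
  finally show "\<bar>u x - u y\<bar>\<^sup>2 \<le> 2 / w0 * energy u"
    using w0_pos by (simp add: field_simps)
qed

text \<open>The zero-order term at \<open>z\<close> alone is at most the energy, and
  \<open>h z \<ge> a0\<close>.\<close>

lemma base_le_energy:
  assumes "finite_energy u"
  shows "\<bar>u z\<bar> \<le> sqrt (1 / (meas G z * a0) * energy u)"
proof (rule real_le_rsqrt)
  have "meas G z * a0 * (u z)\<^sup>2 \<le> meas G z * h z * (u z)\<^sup>2"
    using meas_pos[OF z_vert] h_ge[OF z_vert] by (intro mult_right_mono mult_left_mono) auto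
  also have "\<dots> \<le> bform u u z"
    unfolding bform_eq_grad_norm[OF z_vert]
    using meas_pos[OF z_vert] by (simp add: algebra_simps)
  also have "\<dots> \<le> energy u"
    by (rule bform_le_energy[OF assms z_vert])
  finally show "\<bar>u z\<bar>\<^sup>2 \<le> 1 / (meas G z * a0) * energy u"
    using meas_pos[OF z_vert] a0_pos by (simp add: field_simps)
qed

text \<open>The first summand bounds the increment per edge, the second the value at
  \<open>z\<close>.\<close>

definition growth_const :: real where
  "growth_const = sqrt (2 / w0) + sqrt (1 / (meas G z * a0))"

lemma growth_const_nonneg: "growth_const \<ge> 0"
  using w0_pos a0_pos meas_pos[OF z_vert] by (simp add: growth_const_def)

text \<open>Summing the edge estimate along a shortest path to \<open>z\<close>.\<close>

lemma abs_le_growth: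
  assumes u: "finite_energy u" and x: "x \<in> V"
  shows "\<bar>u x\<bar> \<le> growth_const * sqrt (energy u) * growth x"
proof -
  obtain xs where xs: "graph_path G x xs z" "length xs = Suc (graph_dist G x z)"
    using ex_shortest_path[OF x z_vert] by blast
  have "\<bar>u (hd xs) - u (last xs)\<bar> \<le> real (length xs - 1) * sqrt (2 / w0 * energy u)"
    using xs(1) diff_le_energy[OF u] unfolding graph_path_def
    by (intro hd_last_diff_le[where P = "adj G"]) auto
  then have "\<bar>u x - u z\<bar> \<le> real (graph_dist G x z) * (sqrt (2 / w0) * sqrt (energy u))"
    using xs by (simp add: graph_path_def flip: real_sqrt_mult)
  also have "\<dots> \<le> growth x * (sqrt (2 / w0) * sqrt (energy u))"
    using w0_pos energy_nonneg by (intro mult_right_mono) auto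
  finally have 1: "\<bar>u x - u z\<bar> \<le> growth x * (sqrt (2 / w0) * sqrt (energy u))" .
  have "\<bar>u z\<bar> \<le> 1 * (sqrt (1 / (meas G z * a0)) * sqrt (energy u))"
    using base_le_energy[OF u] by (simp only: real_sqrt_mult mult_1)
  also have "\<dots> \<le> growth x * (sqrt (1 / (meas G z * a0)) * sqrt (energy u))"
    using a0_pos meas_pos[OF z_vert] energy_nonneg by (intro mult_right_mono) auto
  finally have "\<bar>u x\<bar> \<le> growth x * (sqrt (2 / w0) * sqrt (energy u))
      + growth x * (sqrt (1 / (meas G z * a0)) * sqrt (energy u))"
    using 1 by linarith
  also have "\<dots> = growth_const * sqrt (energy u) * growth x"
    by (simp add: growth_const_def ring_distribs mult_ac)
  finally show ?thesis .
qed

lemma abs_le_growth_mono: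
  assumes "finite_energy u" "energy u \<le> c" "x \<in> V"
  shows "\<bar>u x\<bar> \<le> growth_const * sqrt c * growth x"
proof -
  have "growth_const * sqrt (energy u) * growth x \<le> growth_const * sqrt c * growth x"
    using assms(2) growth_const_nonneg growth_pos[of x]
    by (intro mult_right_mono mult_left_mono) auto
  then show ?thesis
    using abs_le_growth[OF assms(1,3)] by (rule order_trans[rotated])
qed

text \<open>Where the distance \<open>r\<close> is at least 1, \<open>1 + r \<le> 2 * r\<close> and
  \<open>r powr q \<le> r powr p\<close>, so the integrable \<open>p\<close>-th power dominates. The
  remaining vertices form the ball of radius 1, which is finite.\<close>

lemma summable_growth: "(\<lambda>x. meas G x * growth x powr q) summable_on V"
proof -
  let ?r = "\<lambda>x. real (graph_dist G x z)"
  have "(\<lambda>x. meas G x * ?r x powr p) summable_on V"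
    using dist_Lp by (simp add: Lq_space_def graph_integrable_def)
  then have s: "(\<lambda>x. 2 powr q * (meas G x * ?r x powr p)) summable_on V"
    by (rule summable_on_cmult_right)
  have far: "meas G x * growth x powr q \<le> 2 powr q * (meas G x * ?r x powr p)"
    if "x \<in> V" "graph_dist G x z \<noteq> 0" for x
  proof -
    have "growth x powr q \<le> (2 * ?r x) powr q"
      using that q_gt by (intro powr_mono2) auto
    also have "\<dots> = 2 powr q * ?r x powr q"
      by (simp add: powr_mult)
    also have "\<dots> \<le> 2 powr q * ?r x powr p"
      using that q_less by (intro mult_left_mono powr_mono) auto
    finally show ?thesis
      using meas_pos[OF that(1)] by (simp add: mult.left_commute)
  qed
  define S where "S = {x \<in> V. graph_dist G x z < 1}"
  have "finite S"
    using locally_finite[unfolded locally_finite_graph_def, rule_format, OF z_vert, of 1]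
    by (simp add: S_def)
  have "(\<lambda>x. meas G x * growth x powr q) summable_on (V - S)"
  proof (rule summable_on_comparison_test)
    show "(\<lambda>x. 2 powr q * (meas G x * ?r x powr p)) summable_on (V - S)"
      using s by (rule summable_on_subset_banach) auto
  qed (use far meas_pos in \<open>auto simp: S_def less_imp_le\<close>)
  then have "(\<lambda>x. meas G x * growth x powr q) summable_on (V - S \<union> S)"
    using \<open>finite S\<close> by (intro summable_on_Un_disjoint) auto
  moreover have "V - S \<union> S = V" by (auto simp: S_def)
  ultimately show ?thesis by simp
qed

section \<open>The \<open>L^q\<close> constraint\<close>

text \<open>The \<open>q\<close>-th power of the \<open>L^q\<close> norm; without the root, changing
  one value changes one summand.\<close>

definition Lq_int :: "('a \<Rightarrow> real) \<Rightarrow> real" where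
  "Lq_int u = (\<Sum>\<^sub>\<infinity>x\<in>V. meas G x * \<bar>u x\<bar> powr q)"

lemma Lq_int_nonneg: "Lq_int u \<ge> 0"
  unfolding Lq_int_def using meas_pos by (intro infsum_nonneg) (auto simp: less_imp_le)

lemma Lq_int_scale: "Lq_int (\<lambda>x. c * u x) = \<bar>c\<bar> powr q * Lq_int u"
  unfolding Lq_int_def
  by (simp add: abs_mult powr_mult mult.left_commute flip: infsum_cmult_right')

text \<open>Dominated convergence with majorant
  \<open>C powr q * (meas G x * growth x powr q)\<close>. It takes the place of a compact embedding
  into \<open>L^q\<close>.\<close>

lemma tendsto_Lq_int:
  assumes bound: "\<And>n x. x \<in> V \<Longrightarrow> \<bar>f n x\<bar> \<le> C * growth x"
    and lim: "\<And>x. x \<in> V \<Longrightarrow> ((\<lambda>n. f n x) \<longlongrightarrow> u x) F" and "F \<noteq> bot"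
  shows "((\<lambda>n. Lq_int (f n)) \<longlongrightarrow> Lq_int u) F"
  unfolding Lq_int_def
proof (rule tendsto_infsum_dominated)
  have u: "\<bar>u x\<bar> \<le> C * growth x" if "x \<in> V" for x
    using tendsto_rabs[OF lim[OF that]] bound[OF that] \<open>F \<noteq> bot\<close>
    by (intro tendsto_upperbound[of "\<lambda>n. \<bar>f n x\<bar>"]) auto
  have dom: "\<bar>meas G x * \<bar>s\<bar> powr q\<bar> \<le> C powr q * (meas G x * growth x powr q)"
    if "x \<in> V" "\<bar>s\<bar> \<le> C * growth x" for x s
  proof -
    have "C * growth x \<ge> 0" using that(2) by linarith
    \<comment> \<open>The sign of \<open>C\<close> is not assumed; it follows from the bound at
      \<open>x\<close> and positivity of \<open>growth x\<close>.\<close>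
    then have "C \<ge> 0"
      using growth_pos[of x] by (simp add: zero_le_mult_iff)
    have "\<bar>s\<bar> powr q \<le> (C * growth x) powr q"
      using that q_gt by (intro powr_mono2) auto
    also have "\<dots> = C powr q * growth x powr q"
      using \<open>C \<ge> 0\<close> by (simp add: powr_mult)
    finally show ?thesis
      using meas_pos[OF that(1)] by (simp add: abs_mult mult.left_commute)
  qed
  show "(\<lambda>x. C powr q * (meas G x * growth x powr q)) summable_on V"
    by (rule summable_on_cmult_right[OF summable_growth])
  show "\<bar>meas G x * \<bar>f n x\<bar> powr q\<bar> \<le> C powr q * (meas G x * growth x powr q)"
    if "x \<in> V" for n x
    using dom bound that by blast
  show "\<bar>meas G x * \<bar>u x\<bar> powr q\<bar> \<le> C powr q * (meas G x * growth x powr q)"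
    if "x \<in> V" for x
    using dom u that by blast
  show "((\<lambda>n. meas G x * \<bar>f n x\<bar> powr q) \<longlongrightarrow> meas G x * \<bar>u x\<bar> powr q) F" if "x \<in> V" for x
    using lim[OF that] q_gt by (intro tendsto_intros) auto
qed

lemma Lq_int_add_indicator:
  assumes "\<phi> \<in> Cc G" "a \<in> V"
  shows "Lq_int (\<lambda>x. \<phi> x + t * indicator {a} x) =
    Lq_int \<phi> + meas G a * (\<bar>\<phi> a + t\<bar> powr q - \<bar>\<phi> a\<bar> powr q)"
proof -
  have "(\<lambda>x. meas G x * \<bar>\<phi> x\<bar> powr q) summable_on V \<longleftrightarrow>
      (\<lambda>x. meas G x * \<bar>\<phi> x\<bar> powr q) summable_on {x \<in> V. \<phi> x \<noteq> 0}"
    by (intro summable_on_cong_neutral) auto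
  then have "((\<lambda>x. meas G x * \<bar>\<phi> x\<bar> powr q) has_sum Lq_int \<phi>) V"
    using assms(1) unfolding Lq_int_def by (intro has_sum_infsum) (simp add: Cc_def)
  moreover have "((\<lambda>x. meas G a * (\<bar>\<phi> a + t\<bar> powr q - \<bar>\<phi> a\<bar> powr q) * indicator {a} x) has_sum
      meas G a * (\<bar>\<phi> a + t\<bar> powr q - \<bar>\<phi> a\<bar> powr q)) V"
    using assms(2) by (intro has_sum_finite_neutralI[of "{a}"]) auto
  ultimately have "((\<lambda>x. meas G x * \<bar>\<phi> x\<bar> powr q
        + meas G a * (\<bar>\<phi> a + t\<bar> powr q - \<bar>\<phi> a\<bar> powr q) * indicator {a} x) has_sum
      Lq_int \<phi> + meas G a * (\<bar>\<phi> a + t\<bar> powr q - \<bar>\<phi> a\<bar> powr q)) V"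
    by (rule has_sum_add)
  also have "(\<lambda>x. meas G x * \<bar>\<phi> x\<bar> powr q
        + meas G a * (\<bar>\<phi> a + t\<bar> powr q - \<bar>\<phi> a\<bar> powr q) * indicator {a} x) =
      (\<lambda>x. meas G x * \<bar>\<phi> x + t * indicator {a} x\<bar> powr q)"
    by (auto simp: indicator_def algebra_simps)
  finally show ?thesis
    unfolding Lq_int_def by (rule infsumI)
qed

section \<open>The constrained minimisation problem\<close>

text \<open>The infimum is taken over finitely supported functions only, so that the minimiser is
  obtained as a limit in the energy norm and lies in \<open>H_space\<close> without any weak closedness argument.\<close>

definition ground :: real where
  "ground = Inf (energy ` {\<phi> \<in> Cc G. Lq_int \<phi> = 1})"

lemma Cc_scale: "\<phi> \<in> Cc G \<Longrightarrow> (\<lambda>x. c * \<phi> x) \<in> Cc G"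
  unfolding Cc_def by (auto elim: rev_finite_subset)

lemma Cc_add_indicator:
  assumes "\<phi> \<in> Cc G"
  shows "(\<lambda>x. \<phi> x + t * indicator {a} x) \<in> Cc G"
proof -
  have "{x \<in> V. \<phi> x + t * indicator {a} x \<noteq> 0} \<subseteq> insert a {x \<in> V. \<phi> x \<noteq> 0}"
    by (auto simp: indicator_def)
  then show ?thesis
    using assms unfolding Cc_def by (auto intro: finite_subset)
qed

lemma Cc_add:
  assumes "\<phi> \<in> Cc G" "\<psi> \<in> Cc G"
  shows "(\<lambda>x. \<phi> x + \<psi> x) \<in> Cc G"
proof -
  have "{x \<in> V. \<phi> x + \<psi> x \<noteq> 0} \<subseteq> {x \<in> V. \<phi> x \<noteq> 0} \<union> {x \<in> V. \<psi> x \<noteq> 0}"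
    by auto
  then show ?thesis
    using assms unfolding Cc_def by (auto intro: finite_subset)
qed

lemma Lq_int_normalize:
  assumes "Lq_int \<phi> > 0"
  shows "Lq_int (\<lambda>x. Lq_int \<phi> powr (- 1 / q) * \<phi> x) = 1"
proof -
  have "(Lq_int \<phi> powr (- 1 / q)) powr q = Lq_int \<phi> powr (- 1)"
    unfolding powr_powr using q_gt by simp
  then show ?thesis
    using assms by (simp only: Lq_int_scale abs_of_nonneg[OF powr_ge_zero]) (simp add: powr_minus)
qed

text \<open>A rescaled point mass at \<open>z\<close> is admissible, so the infimum
  \<open>ground\<close> is over a nonempty set.\<close>

lemma ex_normalized: "{\<phi> \<in> Cc G. Lq_int \<phi> = 1} \<noteq> {}"
proof -
  have "(\<lambda>_. 0) \<in> Cc G" by (simp add: Cc_def)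
  from Cc_add_indicator[OF this, of 1 z] Lq_int_add_indicator[OF this z_vert, of 1]
  have "indicator {z} \<in> Cc G" "Lq_int (indicator {z}) = meas G z"
    using q_gt by (auto simp: Lq_int_def)
  with Lq_int_normalize[of "indicator {z}"] Cc_scale[of "indicator {z}"] meas_pos[OF z_vert]
  show ?thesis by fastforce
qed

text \<open>The homogeneous form of the definition of \<open>ground\<close>: normalise
  \<open>\<phi>\<close> by \<open>c\<close> and use that the energy scales by
  \<open>c\<^sup>2\<close>. It spares later arguments from renormalising perturbed
  functions.\<close>

lemma ground_le_energy:
  assumes "\<phi> \<in> Cc G"
  shows "ground * Lq_int \<phi> powr (2 / q) \<le> energy \<phi>"
proof (cases "Lq_int \<phi> > 0")
  case True
  define c where "c = Lq_int \<phi> powr (- 1 / q)"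
  have "c > 0" using True by (simp add: c_def)
  have "ground \<le> energy (\<lambda>x. c * \<phi> x)"
    unfolding ground_def using Lq_int_normalize[OF True] Cc_scale[OF assms] energy_nonneg
    by (intro cInf_lower bdd_belowI[of _ 0]) (auto simp: c_def)
  also have "\<dots> = c\<^sup>2 * energy \<phi>" by (rule energy_scale)
  also have "c\<^sup>2 = Lq_int \<phi> powr (- (2 / q))"
    using True by (simp add: c_def powr_powr flip: powr_numeral)
  finally show ?thesis
    using True by (simp add: powr_minus field_simps)
next
  case False
  \<comment> \<open>\<open>0 powr (2 / q)\<close> is 0, so the left-hand side vanishes.\<close>
  then have "Lq_int \<phi> = 0" using Lq_int_nonneg[of \<phi>] by simp
  then show ?thesis using energy_nonneg[of \<phi>] by simp
qed

lemma ex_minimizing_sequence: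
  obtains \<phi> :: "nat \<Rightarrow> 'a \<Rightarrow> real" and u
  where "\<And>n. \<phi> n \<in> Cc G" "\<And>n. Lq_int (\<phi> n) = 1" "(\<lambda>n. energy (\<phi> n)) \<longlonglongrightarrow> ground"
    "\<And>n. energy (\<phi> n) \<le> ground + 1" "\<And>x. x \<in> V \<Longrightarrow> (\<lambda>n. \<phi> n x) \<longlonglongrightarrow> u x"
proof -
  have "\<exists>\<phi>. \<phi> \<in> Cc G \<and> Lq_int \<phi> = 1 \<and> energy \<phi> < ground + 1 / real (Suc n)" for n
  proof -
    have "Inf (energy ` {\<phi> \<in> Cc G. Lq_int \<phi> = 1}) < ground + 1 / real (Suc n)"
      by (simp add: ground_def)
    then obtain e where "e \<in> energy ` {\<phi> \<in> Cc G. Lq_int \<phi> = 1}" "e < ground + 1 / real (Suc n)"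
      using cInf_lessD ex_normalized by (metis (no_types, lifting) image_is_empty)
    then show ?thesis by auto
  qed
  then obtain \<phi> where \<phi>: "\<And>n. \<phi> n \<in> Cc G" "\<And>n. Lq_int (\<phi> n) = 1"
      "\<And>n. energy (\<phi> n) < ground + 1 / real (Suc n)"
    by metis
  have lower: "ground \<le> energy (\<phi> n)" for n
    using ground_le_energy[OF \<phi>(1)[of n]] by (simp add: \<phi>(2))
  have above: "(\<lambda>n. ground + 1 / real (Suc n)) \<longlonglongrightarrow> ground"
    using LIMSEQ_inverse_real_of_nat_add[of ground] by (simp only: inverse_eq_divide)
  have lim: "(\<lambda>n. energy (\<phi> n)) \<longlonglongrightarrow> ground"
    by (rule tendsto_sandwich[OF _ _ tendsto_const above])
       (rule always_eventually, use lower less_imp_le[OF \<phi>(3)] in blast)+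
  have upper: "energy (\<phi> n) \<le> ground + 1" for n
  proof -
    have "1 / real (Suc n) \<le> 1" by simp
    with \<phi>(3)[of n] show ?thesis by linarith
  qed
  \<comment> \<open>Dividing by \<open>growth x\<close> makes the bound uniform in \<open>x\<close>
    as well as \<open>n\<close>, as the diagonal argument requires; the factor is restored in the
    limit.\<close>
  have bound: "norm (\<phi> n x / growth x) \<le> growth_const * sqrt (ground + 1)" if "x \<in> V" for n x
  proof -
    have "\<bar>\<phi> n x\<bar> \<le> growth_const * sqrt (ground + 1) * growth x"
      by (rule abs_le_growth_mono[OF finite_energy_Cc[OF \<phi>(1)] upper that])
    then show ?thesis
      by (simp add: divide_le_eq)
  qed
  obtain k where k: "strict_mono k"
      "\<And>x. x \<in> V \<Longrightarrow> \<exists>l. (\<lambda>n. \<phi> (k n) x / growth x) \<longlonglongrightarrow> l"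
    using function_convergent_subsequence
      [of V "\<lambda>n x. \<phi> n x / growth x", OF countable_verts bound] by blast
  then obtain l where l: "\<And>x. x \<in> V \<Longrightarrow> (\<lambda>n. \<phi> (k n) x / growth x) \<longlonglongrightarrow> l x"
    by metis
  have "(\<lambda>n. \<phi> (k n) x) \<longlonglongrightarrow> l x * growth x" if "x \<in> V" for x
    using tendsto_mult_right[OF l[OF that], of "growth x"] growth_pos[of x] by simp
  moreover have "(\<lambda>n. energy (\<phi> (k n))) \<longlonglongrightarrow> ground"
    using LIMSEQ_subseq_LIMSEQ[OF lim k(1)] by (simp add: o_def)
  ultimately show ?thesis
    using that[of "\<lambda>n. \<phi> (k n)" "\<lambda>x. l x * growth x"] \<phi> upper by blast
qed

section \<open>The limit of a minimising sequence\<close>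

context
  fixes \<phi> :: "nat \<Rightarrow> 'a \<Rightarrow> real" and u :: "'a \<Rightarrow> real"
  assumes phi_Cc: "\<And>n. \<phi> n \<in> Cc G" and phi_norm: "\<And>n. Lq_int (\<phi> n) = 1"
    and phi_energy: "(\<lambda>n. energy (\<phi> n)) \<longlonglongrightarrow> ground"
    and phi_le: "\<And>n. energy (\<phi> n) \<le> ground + 1"
    and phi_lim: "\<And>x. x \<in> V \<Longrightarrow> (\<lambda>n. \<phi> n x) \<longlonglongrightarrow> u x"
begin

lemma phi_bound: "x \<in> V \<Longrightarrow> \<bar>\<phi> n x\<bar> \<le> growth_const * sqrt (ground + 1) * growth x"
  by (rule abs_le_growth_mono[OF finite_energy_Cc[OF phi_Cc] phi_le])

lemma Lq_int_limit: "Lq_int u = 1"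
proof -
  have "(\<lambda>n. Lq_int (\<phi> n)) \<longlonglongrightarrow> Lq_int u"
    using phi_bound phi_lim by (intro tendsto_Lq_int) auto
  then show ?thesis
    using phi_norm by (simp add: LIMSEQ_const_iff)
qed

lemma limit_nonzero: "\<exists>x\<in>V. u x \<noteq> 0"
proof (rule ccontr)
  assume "\<not> ?thesis"
  then have "Lq_int u = 0"
    unfolding Lq_int_def by (intro infsum_0) auto
  then show False using Lq_int_limit by simp
qed

text \<open>If \<open>ground\<close> were 0, the growth bound would force the pointwise limit to
  vanish, contradicting \<open>Lq_int u = 1\<close>.\<close>

lemma ground_pos: "ground > 0"
proof -
  obtain x where x: "x \<in> V" "u x \<noteq> 0"
    using limit_nonzero by auto
  have "\<bar>u x\<bar> \<le> growth_const * sqrt ground * growth x"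
  proof (rule tendsto_le[OF sequentially_bot])
    show "(\<lambda>n. growth_const * sqrt (energy (\<phi> n)) * growth x) \<longlonglongrightarrow> growth_const * sqrt ground * growth x"
      by (intro tendsto_intros phi_energy)
    show "(\<lambda>n. \<bar>\<phi> n x\<bar>) \<longlonglongrightarrow> \<bar>u x\<bar>"
      by (intro tendsto_intros phi_lim x)
    show "\<forall>\<^sub>F n in sequentially. \<bar>\<phi> n x\<bar> \<le> growth_const * sqrt (energy (\<phi> n)) * growth x"
      using abs_le_growth[OF finite_energy_Cc[OF phi_Cc] x(1)] by (intro always_eventually allI)
  qed
  with x(2) have "ground \<noteq> 0" by auto
  moreover have "ground \<ge> 0"
    using energy_nonneg by (intro tendsto_lowerbound[OF phi_energy]) auto
  ultimately show ?thesis by simp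
qed

text \<open>The midpoints of the minimising sequence have asymptotically full \<open>L^q\<close> norm, hence energy
  at least \<open>ground\<close> in the limit, and the parallelogram law makes the sequence Cauchy.\<close>

lemma minimizing_Cauchy:
  assumes "e > 0"
  shows "\<exists>N. \<forall>n\<ge>N. \<forall>m\<ge>N. energy (\<lambda>x. \<phi> m x - \<phi> n x) < e"
proof -
  \<comment> \<open>The product filter lets both indices tend to infinity independently.\<close>
  let ?F = "sequentially \<times>\<^sub>F sequentially"
  define mid where "mid = (\<lambda>i x. 1 / 2 * (\<phi> (fst i) x + \<phi> (snd i) x))"
  have pair: "((\<lambda>i. f (fst i)) \<longlongrightarrow> L) ?F \<and> ((\<lambda>i. f (snd i)) \<longlongrightarrow> L) ?F"
    if "f \<longlonglongrightarrow> L" for f and L :: real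
    using filterlim_compose[OF that filterlim_fst] filterlim_compose[OF that filterlim_snd] by blast
  have "((\<lambda>i. Lq_int (mid i)) \<longlongrightarrow> Lq_int u) ?F"
  proof (rule tendsto_Lq_int)
    show "\<bar>mid i x\<bar> \<le> growth_const * sqrt (ground + 1) * growth x" if "x \<in> V" for i x
      using phi_bound[OF that, of "fst i"] phi_bound[OF that, of "snd i"] by (simp add: mid_def)
    show "((\<lambda>i. mid i x) \<longlongrightarrow> u x) ?F" if "x \<in> V" for x
      unfolding mid_def using pair[OF phi_lim[OF that]] by (auto intro!: tendsto_eq_intros)
  qed (simp add: prod_filter_eq_bot)
  then have mid: "((\<lambda>i. Lq_int (mid i)) \<longlongrightarrow> 1) ?F"
    by (simp add: Lq_int_limit)
  \<comment> \<open>In the parallelogram law, the energy of the sum is 4 times that of the midpoint,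
    which \<open>ground_le_energy\<close> bounds below. The right-hand side tends to
    \<open>2 * ground + 2 * ground - 4 * ground = 0\<close>.\<close>
  have le: "energy (\<lambda>x. \<phi> (snd i) x - \<phi> (fst i) x)
      \<le> 2 * energy (\<phi> (snd i)) + 2 * energy (\<phi> (fst i)) - 4 * (ground * Lq_int (mid i) powr (2 / q))"
    for i
  proof -
    have "mid i \<in> Cc G"
      unfolding mid_def by (intro Cc_scale Cc_add phi_Cc)
    then have "ground * Lq_int (mid i) powr (2 / q) \<le> energy (mid i)"
      by (rule ground_le_energy)
    moreover have "energy (mid i) = (1 / 2)\<^sup>2 * energy (\<lambda>x. \<phi> (fst i) x + \<phi> (snd i) x)"
      unfolding mid_def by (rule energy_scale)
    moreover have "(\<lambda>x. \<phi> (fst i) x + \<phi> (snd i) x) = (\<lambda>x. \<phi> (snd i) x + \<phi> (fst i) x)"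
      by (simp add: add.commute)
    ultimately show ?thesis
      using parallelogram_energy[OF finite_energy_Cc finite_energy_Cc, OF phi_Cc phi_Cc, of "snd i" "fst i"]
      by (simp add: power2_eq_square)
  qed
  have "((\<lambda>i. 2 * energy (\<phi> (snd i)) + 2 * energy (\<phi> (fst i)) - 4 * (ground * Lq_int (mid i) powr (2 / q)))
      \<longlongrightarrow> 2 * ground + 2 * ground - 4 * (ground * 1 powr (2 / q))) ?F"
    using pair[OF phi_energy] mid by (intro tendsto_intros) auto
  then have "\<forall>\<^sub>F i in ?F. 2 * energy (\<phi> (snd i)) + 2 * energy (\<phi> (fst i))
      - 4 * (ground * Lq_int (mid i) powr (2 / q)) < e"
    using assms by (intro order_tendstoD(2)) auto
  then have "\<forall>\<^sub>F i in ?F. energy (\<lambda>x. \<phi> (snd i) x - \<phi> (fst i) x) < e"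
    by (rule eventually_mono) (use le le_less_trans in blast)
  then show ?thesis
    unfolding eventually_prod_sequentially by auto
qed

lemma limit_energy:
  "finite_energy u" "(\<lambda>n. energy (\<lambda>x. u x - \<phi> n x)) \<longlonglongrightarrow> 0"
proof -
  show "finite_energy u"
    using finite_energy_Cc[OF phi_Cc] phi_lim phi_le
    by (intro energy_Fatou(1)[of \<phi> u sequentially "ground + 1"]) auto
  show "(\<lambda>n. energy (\<lambda>x. u x - \<phi> n x)) \<longlonglongrightarrow> 0"
  proof (rule LIMSEQ_I)
    fix e :: real assume "e > 0"
    then obtain N where N: "\<And>n m. n \<ge> N \<Longrightarrow> m \<ge> N \<Longrightarrow> energy (\<lambda>x. \<phi> m x - \<phi> n x) < e / 2"
      using minimizing_Cauchy[of "e / 2"] by auto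
    \<comment> \<open>Fatou in \<open>m\<close> with \<open>n\<close> fixed; starting from
      \<open>e / 2\<close> leaves a strict inequality at the end.\<close>
    have "energy (\<lambda>x. u x - \<phi> n x) \<le> e / 2" if "n \<ge> N" for n
    proof (rule energy_Fatou(2))
      show "finite_energy (\<lambda>x. \<phi> m x - \<phi> n x)" for m
        by (intro finite_energy_add_diff finite_energy_Cc phi_Cc)
      show "(\<lambda>m. \<phi> m x - \<phi> n x) \<longlonglongrightarrow> u x - \<phi> n x" if "x \<in> V" for x
        by (intro tendsto_intros phi_lim that)
      show "\<forall>\<^sub>F m in sequentially. energy (\<lambda>x. \<phi> m x - \<phi> n x) \<le> e / 2"
        using N[OF that] by (intro eventually_sequentiallyI[of N]) (simp add: less_imp_le)
    qed simp
    then show "\<exists>N. \<forall>n\<ge>N. norm (energy (\<lambda>x. u x - \<phi> n x) - 0) < e"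
      using \<open>e > 0\<close> energy_nonneg by (intro exI[of _ N]) fastforce
  qed
qed

section \<open>The Euler-Lagrange equation and removal of the multiplier\<close>

text \<open>Since \<open>ground_le_energy\<close> concerns \<open>Cc G\<close>, the perturbation is
  applied to \<open>\<phi> n\<close>, and only then does \<open>n\<close> tend to infinity. The
  resulting \<open>g\<close> is nonnegative near 0 with \<open>g 0 = 0\<close>, so its derivative
  there vanishes.\<close>

lemma Euler_Lagrange:
  assumes a: "a \<in> V"
  shows "- graph_laplacian G u a + h a * u a = ground * (\<bar>u a\<bar> powr (q - 2) * u a)"
proof -
  define B where "B = (\<lambda>u. meas G a * (- graph_laplacian G u a + h a * u a))"
  define D where "D = energy (indicator {a})"
  \<comment> \<open>\<open>P s t\<close> is \<open>Lq_int\<close> of a function of constraint value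
    1 whose value \<open>s\<close> at \<open>a\<close> is raised by \<open>t\<close>.\<close>
  define P where "P = (\<lambda>s t. 1 + meas G a * (\<bar>s + t\<bar> powr q - \<bar>s\<bar> powr q))"
  define g where "g = (\<lambda>t. ground + 2 * t * B u + t\<^sup>2 * D - ground * P (u a) t powr (2 / q))"
  have g_lim: "(\<lambda>n. energy (\<phi> n) + 2 * t * B (\<phi> n) + t\<^sup>2 * D - ground * P (\<phi> n a) t powr (2 / q)) \<longlonglongrightarrow> g t"
    if "P (u a) t \<noteq> 0" for t
  proof -
    have "(\<lambda>n. B (\<phi> n)) \<longlonglongrightarrow> B u"
      unfolding B_def graph_laplacian_def using a adj_verts
      by (intro tendsto_intros phi_lim) auto
    moreover have "(\<lambda>n. P (\<phi> n a) t) \<longlonglongrightarrow> P (u a) t"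
      unfolding P_def using q_gt by (intro tendsto_intros phi_lim a) auto
    ultimately show ?thesis
      unfolding g_def using that by (intro tendsto_intros phi_energy) auto
  qed
  have nonneg: "energy (\<phi> n) + 2 * t * B (\<phi> n) + t\<^sup>2 * D - ground * P (\<phi> n a) t powr (2 / q) \<ge> 0" for n t
  proof -
    have "ground * Lq_int (\<lambda>x. \<phi> n x + t * indicator {a} x) powr (2 / q)
        \<le> energy (\<lambda>x. \<phi> n x + t * indicator {a} x)"
      by (intro ground_le_energy Cc_add_indicator phi_Cc)
    then show ?thesis
      unfolding energy_add_indicator[OF finite_energy_Cc[OF phi_Cc] a]
        Lq_int_add_indicator[OF phi_Cc a] phi_norm
      by (simp add: B_def D_def P_def)
  qed
  have P0: "P (u a) 0 = 1"
    by (simp add: P_def)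
  have P_deriv: "(P (u a) has_real_derivative meas G a * (q * (\<bar>u a\<bar> powr (q - 2) * u a))) (at 0)"
  proof -
    have "((\<lambda>t. \<bar>u a + t\<bar> powr q) has_real_derivative q * (\<bar>u a\<bar> powr (q - 2) * u a)) (at 0)"
      using DERIV_abs_powr[of q "u a"] q_gt DERIV_shift[of "\<lambda>t. \<bar>t\<bar> powr q" _ "0" "u a"]
      by (simp add: add.commute)
    then show ?thesis
      unfolding P_def
      by (intro DERIV_cong[OF DERIV_add[OF DERIV_const DERIV_cmult[OF DERIV_diff[OF _ DERIV_const]]]])
         auto
  qed
  have "(P (u a) \<longlongrightarrow> 1) (at 0)"
    using DERIV_isCont[OF P_deriv] P0 by (simp add: isCont_def)
  \<comment> \<open>Near \<open>t = 0\<close> the base stays away from 0, which allows passing to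
    the limit in the power \<open>2 / q\<close>.\<close>
  then have "\<forall>\<^sub>F t in at 0. P (u a) t > 0"
    by (rule order_tendstoD) simp
  then obtain d where d: "d > 0" "\<And>t. t \<noteq> 0 \<Longrightarrow> \<bar>t\<bar> < d \<Longrightarrow> P (u a) t > 0"
    by (auto simp: eventually_at dist_real_def)
  have g_min: "g t \<ge> g 0" if "\<bar>t\<bar> < d" for t
  proof (cases "t = 0")
    case False
    have "g t \<ge> 0"
      using g_lim[of t] d(2)[OF False that] nonneg[where t = t]
      by (intro tendsto_lowerbound[OF g_lim[of t]]) auto
    then show ?thesis
      by (simp add: g_def P0)
  qed simp
  have "(g has_real_derivative
      2 * B u - ground * (2 * (meas G a * (\<bar>u a\<bar> powr (q - 2) * u a)))) (at 0)"
  proof -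
    \<comment> \<open>The exponent \<open>2 / q\<close> cancels the factor \<open>q\<close> from the
      derivative of \<open>P\<close>, leaving 2.\<close>
    have "((\<lambda>t. P (u a) t powr (2 / q)) has_real_derivative
        2 * (meas G a * (\<bar>u a\<bar> powr (q - 2) * u a))) (at 0)"
      using DERIV_fun_powr[OF P_deriv, of "2 / q"] P0 q_gt by simp
    moreover have "((\<lambda>t. ground + 2 * t * B u + t\<^sup>2 * D) has_real_derivative 2 * B u) (at 0)"
      by (auto intro!: derivative_eq_intros)
    ultimately show ?thesis
      unfolding g_def by (intro DERIV_diff DERIV_cmult)
  qed
  then have "2 * B u - ground * (2 * (meas G a * (\<bar>u a\<bar> powr (q - 2) * u a))) = 0"
    by (rule DERIV_local_min[OF _ d(1)]) (simp add: g_min)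
  then have "meas G a * (- graph_laplacian G u a + h a * u a)
      = meas G a * (ground * (\<bar>u a\<bar> powr (q - 2) * u a))"
    by (simp add: B_def)
  then show ?thesis
    using meas_pos[OF a] by simp
qed

lemma rescaled_solution:
  "\<exists>v \<in> H_space G h.
     (\<forall>x\<in>V. - graph_laplacian G v x + h x * v x = \<bar>v x\<bar> powr (q - 2) * v x) \<and> (\<exists>x\<in>V. v x \<noteq> 0)"
proof -
  \<comment> \<open>For \<open>v = c * u\<close> the left side scales by \<open>c\<close> and the
    nonlinearity by \<open>c powr (q - 1)\<close>, so the multiplier disappears when
    \<open>c powr (q - 2) = ground\<close>.\<close>
  define c where "c = ground powr (1 / (q - 2))"
  have c: "c > 0" "c powr (q - 2) = ground"
    using ground_pos q_gt by (auto simp: c_def powr_powr)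
  define v where "v = (\<lambda>x. c * u x)"
  have "v \<in> H_space G h"
  proof (rule H_spaceI)
    show "finite_energy v"
      unfolding v_def by (intro finite_energy_scale limit_energy)
    show "(\<lambda>x. c * \<phi> n x) \<in> Cc G" for n
      by (intro Cc_scale phi_Cc)
    have "(\<lambda>n. c\<^sup>2 * energy (\<lambda>x. u x - \<phi> n x)) \<longlonglongrightarrow> c\<^sup>2 * 0"
      by (intro tendsto_intros limit_energy)
    then show "(\<lambda>n. energy (\<lambda>x. v x - c * \<phi> n x)) \<longlonglongrightarrow> 0"
      by (simp add: v_def flip: energy_scale right_diff_distrib)
  qed
  moreover have "- graph_laplacian G v x + h x * v x = \<bar>v x\<bar> powr (q - 2) * v x" if "x \<in> V" for x
  proof -
    have "graph_laplacian G v x = c * graph_laplacian G u x"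
      by (simp add: graph_laplacian_def v_def sum_distrib_left algebra_simps)
    then have "- graph_laplacian G v x + h x * v x = c * (- graph_laplacian G u x + h x * u x)"
      by (simp add: v_def algebra_simps)
    also have "\<dots> = \<bar>v x\<bar> powr (q - 2) * v x"
      unfolding Euler_Lagrange[OF that] v_def using c
      by (simp add: abs_mult powr_mult)
    finally show ?thesis .
  qed
  moreover have "\<exists>x\<in>V. v x \<noteq> 0"
    using limit_nonzero c(1) by (simp add: v_def)
  ultimately show ?thesis by blast
qed

end

end

theorem theorem6:
  fixes G :: "'a wgraph" and z :: 'a and h :: "'a \<Rightarrow> real" and w0 a0 p q :: real
  assumes "weighted_graph G" and "connected_graph G" and "locally_finite_graph G"
    and "w0 > 0" and "\<And>x y. x \<in> verts G \<Longrightarrow> y \<in> verts G \<Longrightarrow> adj G x y \<Longrightarrow> weight G x y \<ge> w0"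
    and "z \<in> verts G"
    and "p > 2" and "(\<lambda>x. real (graph_dist G x z)) \<in> Lq_space G p"
    and "a0 > 0" and "\<And>x. x \<in> verts G \<Longrightarrow> h x \<ge> a0"
    and "(\<lambda>x. 1 / h x) \<in> Lq_space G 1 \<or>
         filterlim h at_top (inf (filtercomap (\<lambda>x. graph_dist G x z) at_top) (principal (verts G)))"
    and "2 < q" and "q < p"
  shows "\<exists>u \<in> H_space G h.
           (\<forall>x\<in>verts G. - graph_laplacian G u x + h x * u x = \<bar>u x\<bar> powr (q - 2) * u x) \<and>
           (\<exists>x\<in>verts G. u x \<noteq> 0)"
proof -
  interpret schroedinger_graph G h a0
    by unfold_locales (use assms in auto)
  \<comment> \<open>By \<open>adj_verts\<close> edges join vertices only, so the weight bound holds
    for all adjacent pairs.\<close>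
  interpret schroedinger_nonlinear G h a0 w0 p q z
    by unfold_locales (use assms adj_verts in auto)
  show ?thesis
    by (rule ex_minimizing_sequence) (rule rescaled_solution)
qed

end
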